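(* Let $k,l$ be fixed positive integers and let $\sigma^2>0$. For each $n\ge 1$ let $X_n$ be a random vector in $\mathbb{R}^{d_n}$ such that, as $n\to\infty$, $\|X_n\|^2\to\sigma^2$ in probability and $X_n'\widetilde X_n\to 0$ in probability, where $\widetilde X_n$ denotes an independent copy of $X_n$. For each $n\ge1$ let $X_{n,1},\ldots,X_{n,k}$ be mutually independent copies of $X_n$, and let $\Xi_{n,1},\ldots,\Xi_{n,l}\in\mathbb{R}^{d_n}$ be mutually independent $\mathcal{N}_{d_n}(0,I_{d_n})$-distributed random vectors, all independent of $(X_{n,1},\ldots,X_{n,k})$. Let $\mathcal{Y}_n=(\Xi_{n,j}'X_{n,r})$ be the $l\times k$ random matrix whose $(j,r)$ entry is $\Xi_{n,j}'X_{n,r}$, $j=1,\ldots,l$, $r=1,\ldots,k$. Then, as $n\to\infty$, the conditional distribution of $\mathcal{Y}_n$ given $(\Xi_{n,1},\ldots,\Xi_{n,l})$ converges weakly in probability to the distribution of $\mathcal{Z}$, where $\mathcal{Z}=(Z_{j,r})$ is an $l\times k$ random matrix whose entries $Z_{j,r}$, $j=1,\ldots,l$, $r=1,\ldots,k$, are mutually independent and $\mathcal{N}_1(0,\sigma^2)$-distributed.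
   Context: Conventions: vectors are column vectors, $'$ denotes transpose, $\|\cdot\|$ is the Euclidean norm. The dimensions $d_1,d_2,\ldots$ form a monotonically increasing sequence of positive integers with $d_n\to\infty$. All random vectors $X_n$ and $\Xi_{n,j}$ are continuous with continuous density functions. $\mathcal{N}_d(0,\Sigma)$ is the $d$-dimensional normal distribution with mean $0$ and covariance matrix $\Sigma$; $I_d$ is the $d\times d$ identity matrix. Weak convergence in probability: a conditional distribution given random vectors is a random measure. Random measures $\mu_n$ (on $\mathbb{R}$, or on a finite-dimensional Euclidean space) with random characteristic functions $\widehat\mu_n$ converge weakly in probability to a deterministic measure $\mu_0$ with characteristic function $\widehat\mu_0$ if and only if $\widehat\mu_n(t)\to\widehat\mu_0(t)$ in probability for every fixed argument $t$. For $l\times k$ random matrices, the argument is a constant real $l\times k$ matrix $U$ and the conditional characteristic function is $\mathbb{E}\big[\exp(\mathrm{i}\,\mathrm{tr}(U'\mathcal{Y}_n))\mid \Xi_{n,1},\ldots,\Xi_{n,l}\big]$. *)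

theory Defs
  imports "HOL-Probability.Probability"
begin

text \<open>
  The dimension \<open>d n\<close> varies with \<open>n\<close>, so a vector of \<open>\<real>\<^sup>d\<close> is an element of
  \<open>space (borel_vec d)\<close>: a function on \<open>{..<d}\<close>, extended by \<open>undefined\<close>.
  The matrix dimensions are fixed, so \<open>l \<times> k\<close> matrices have type \<^typ>\<open>real^'k^'l\<close>.
\<close>

abbreviation borel_vec :: "nat \<Rightarrow> (nat \<Rightarrow> real) measure" where
  "borel_vec d \<equiv> Pi\<^sub>M {..<d} (\<lambda>_. borel)"

abbreviation lborel_vec :: "nat \<Rightarrow> (nat \<Rightarrow> real) measure" where
  "lborel_vec d \<equiv> Pi\<^sub>M {..<d} (\<lambda>_. lborel)"

definition inner_vec :: "nat \<Rightarrow> (nat \<Rightarrow> real) \<Rightarrow> (nat \<Rightarrow> real) \<Rightarrow> real" where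
  "inner_vec d x y = (\<Sum>i<d. x i * y i)"

definition norm_vec :: "nat \<Rightarrow> (nat \<Rightarrow> real) \<Rightarrow> real" where
  "norm_vec d x = L2_set x {..<d}"

text \<open>
  On \<open>space (borel_vec d)\<close> the product topology of the function type is the Euclidean topology.
\<close>

definition has_continuous_density :: "'a measure \<Rightarrow> nat \<Rightarrow> ('a \<Rightarrow> nat \<Rightarrow> real) \<Rightarrow> bool" where
  "has_continuous_density M d X \<longleftrightarrow>
     (\<exists>f :: (nat \<Rightarrow> real) \<Rightarrow> real. continuous_on (space (borel_vec d)) f \<and>
        (\<forall>x\<in>space (borel_vec d). 0 \<le> f x) \<and>
        distributed M (lborel_vec d) X (\<lambda>x. ennreal (f x)))"

definition std_normal_vec_density :: "nat \<Rightarrow> (nat \<Rightarrow> real) \<Rightarrow> real" where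
  "std_normal_vec_density d x = (2 * pi) powr (- real d / 2) * exp (- (norm_vec d x)\<^sup>2 / 2)"

definition std_normal_vec :: "'a measure \<Rightarrow> nat \<Rightarrow> ('a \<Rightarrow> nat \<Rightarrow> real) \<Rightarrow> bool" where
  "std_normal_vec M d X \<longleftrightarrow>
     distributed M (lborel_vec d) X (\<lambda>x. ennreal (std_normal_vec_density d x))"

definition copy_of :: "'a measure \<Rightarrow> 'b measure \<Rightarrow> ('a \<Rightarrow> 'b) \<Rightarrow> ('a \<Rightarrow> 'b) \<Rightarrow> bool" where
  "copy_of M S X' X \<longleftrightarrow> X' \<in> measurable M S \<and> distr M S X' = distr M S X"

text \<open>Only deterministic limits occur, so the probability space may depend on the index.\<close>

definition tendsto_in_prob ::
  "(nat \<Rightarrow> 'a measure) \<Rightarrow> (nat \<Rightarrow> 'a \<Rightarrow> 'b::metric_space) \<Rightarrow> 'b \<Rightarrow> bool" where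
  "tendsto_in_prob M Y c \<longleftrightarrow>
     (\<forall>\<epsilon>>0. (\<lambda>n. measure (M n) {\<omega>\<in>space (M n). dist (Y n \<omega>) c > \<epsilon>}) \<longlonglongrightarrow> 0)"

text \<open>
  The \<open>\<sigma>\<close>-algebra generated by a family \<open>W\<close>, as a measurable space on \<open>space M\<close>. Independence of two
  random tuples with different index types is stated through it, since \<open>indep_var\<close> needs both
  variables to have the same type.
\<close>

definition gen_sigma ::
  "'a measure \<Rightarrow> 'b measure \<Rightarrow> ('i \<Rightarrow> 'a \<Rightarrow> 'b) \<Rightarrow> 'a measure" where
  "gen_sigma M S W = vimage_algebra (space M) (\<lambda>\<omega> i. W i \<omega>) (Pi\<^sub>M UNIV (\<lambda>_. S))"

text \<open>
  \<open>\<kappa>\<close> is a (regular) version of the conditional distribution of \<open>Y\<close> given the sub-\<open>\<sigma>\<close>-algebra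
  \<open>F\<close> of \<open>M\<close>; in particular it is a random probability measure on \<open>S\<close>.
\<close>

definition is_cond_distr ::
  "'a measure \<Rightarrow> 'a measure \<Rightarrow> 'b measure \<Rightarrow> ('a \<Rightarrow> 'b) \<Rightarrow> ('a \<Rightarrow> 'b measure) \<Rightarrow> bool" where
  "is_cond_distr M F S Y \<kappa> \<longleftrightarrow>
     \<kappa> \<in> measurable F (prob_algebra S) \<and>
     (\<forall>A\<in>sets S. AE \<omega> in M.
        measure (\<kappa> \<omega>) A = real_cond_exp M F (indicat_real (Y -` A \<inter> space M)) \<omega>)"

definition char_mat :: "(real^'k^'l) measure \<Rightarrow> real^'k^'l \<Rightarrow> complex" where
  "char_mat \<mu> U = (CLINT y|\<mu>. iexp (trace (transpose U ** y)))"

text \<open>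
  Weak convergence in probability of random measures to a deterministic measure, in terms of the
  pointwise convergence in probability of the random characteristic functions.
\<close>

definition weak_conv_in_prob ::
  "(nat \<Rightarrow> 'a measure) \<Rightarrow> (nat \<Rightarrow> 'a \<Rightarrow> (real^'k^'l) measure) \<Rightarrow> (real^'k^'l) measure \<Rightarrow> bool" where
  "weak_conv_in_prob M \<mu> \<mu>\<^sub>0 \<longleftrightarrow>
     (\<forall>U. tendsto_in_prob M (\<lambda>n \<omega>. char_mat (\<mu> n \<omega>) U) (char_mat \<mu>\<^sub>0 U))"

definition inner_matrix ::
  "nat \<Rightarrow> ('l \<Rightarrow> 'a \<Rightarrow> nat \<Rightarrow> real) \<Rightarrow> ('k \<Rightarrow> 'a \<Rightarrow> nat \<Rightarrow> real) \<Rightarrow> 'a \<Rightarrow> real^'k^'l" where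
  "inner_matrix d \<Xi> X \<omega> = (\<chi> j r. inner_vec d (\<Xi> j \<omega>) (X r \<omega>))"

end

theory Submission
  imports Defs
begin

text \<open>
  For a fixed argument \<open>U\<close>, the conditional characteristic function is
  \<open>\<phi>\<^sub>n = E[exp (i h(\<Xi>\<^sub>n, X\<^sub>n)) | \<Xi>\<^sub>n]\<close> with \<open>h\<close> linear in \<open>\<Xi>\<^sub>n\<close>, and its limit is the constant
  \<open>c = exp (- \<sigma>\<^sup>2 \<bar>U\<bar>\<^sup>2 / 2)\<close>. It suffices to show that
  \<open>E \<bar>\<phi>\<^sub>n - c\<bar>\<^sup>2 = E \<bar>\<phi>\<^sub>n\<bar>\<^sup>2 - 2 c Re E \<phi>\<^sub>n + c\<^sup>2\<close> tends to 0. Here \<open>\<bar>\<phi>\<^sub>n\<bar>\<^sup>2\<close> is an integral over two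
  independent copies of the family \<open>X\<^sub>n\<close>. Integrating the Gaussian vectors first, by Fubini, turns
  \<open>E \<phi>\<^sub>n\<close> and \<open>E \<bar>\<phi>\<^sub>n\<bar>\<^sup>2\<close> into expectations of \<open>exp (- Q / 2)\<close>, where \<open>Q\<close> is a quadratic form in the
  inner products of copies of \<open>X\<^sub>n\<close>. These inner products converge in probability to \<open>\<sigma>\<^sup>2\<close> or \<open>0\<close>, so
  the two expectations tend to \<open>c\<close> and \<open>c\<^sup>2\<close>.
\<close>

section \<open>Conditional distributions\<close>

text \<open>A sigma-finite product measure is determined by its values on rectangles, and there
  \<open>prod\<close> is exactly the identity required. \<open>W\<close> and \<open>V\<close> may
  take values in different types, as the two families in the main theorem do.\<close>

lemma (in prob_space) distr_pair_eqI:
  assumes W [measurable]: "W \<in> M \<rightarrow>\<^sub>M S" and V [measurable]: "V \<in> M \<rightarrow>\<^sub>M T"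
    and prod: "\<And>A B. A \<in> sets S \<Longrightarrow> B \<in> sets T \<Longrightarrow>
      prob ((W -` A \<inter> space M) \<inter> (V -` B \<inter> space M)) = prob (W -` A \<inter> space M) * prob (V -` B \<inter> space M)"
  shows "distr M S W \<Otimes>\<^sub>M distr M T V = distr M (S \<Otimes>\<^sub>M T) (\<lambda>\<omega>. (W \<omega>, V \<omega>))"
proof (rule pair_measure_eqI)
  show "sigma_finite_measure (distr M S W)" "sigma_finite_measure (distr M T V)"
    by (simp_all add: prob_space_distr prob_space_imp_sigma_finite)
  fix A B assume AB: "A \<in> sets (distr M S W)" "B \<in> sets (distr M T V)"
  then have AB': "A \<in> sets S" "B \<in> sets T" by auto
  have "(\<lambda>\<omega>. (W \<omega>, V \<omega>)) -` (A \<times> B) \<inter> space M = (W -` A \<inter> space M) \<inter> (V -` B \<inter> space M)"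
    by auto
  with prod[OF AB'] AB' show "emeasure (distr M S W) A * emeasure (distr M T V) B
      = emeasure (distr M (S \<Otimes>\<^sub>M T) (\<lambda>\<omega>. (W \<omega>, V \<omega>))) (A \<times> B)"
    by (simp add: emeasure_distr emeasure_eq_measure ennreal_mult)
qed simp

text \<open>Independence allows \<open>W\<close> to be frozen: conditioning on \<open>W\<close>
  leaves the law of \<open>V\<close> unchanged, so only the randomness of \<open>V\<close> is
  averaged. The joint law is a product, and Fubini then verifies the defining identity of the
  conditional expectation.\<close>

lemma (in prob_space) is_cond_distr_of_indep:
  assumes W: "W \<in> M \<rightarrow>\<^sub>M S" and V: "V \<in> M \<rightarrow>\<^sub>M T"
    and indep: "indep_set (sets (vimage_algebra (space M) W S)) (sets (vimage_algebra (space M) V T))"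
    and g: "g \<in> S \<Otimes>\<^sub>M T \<rightarrow>\<^sub>M R"
  shows "is_cond_distr M (vimage_algebra (space M) W S) R (\<lambda>\<omega>. g (W \<omega>, V \<omega>))
           (\<lambda>\<omega>. distr M R (\<lambda>\<omega>'. g (W \<omega>, V \<omega>')))"
proof -
  let ?F = "vimage_algebra (space M) W S"
  let ?\<kappa> = "\<lambda>\<omega>. distr M R (\<lambda>\<omega>'. g (W \<omega>, V \<omega>'))"
  note [measurable] = W V g
  have Wsp: "W \<in> space M \<rightarrow> space S"
    using measurable_space[OF W] by blast
  have F_sets: "sets ?F = {W -` A \<inter> space M | A. A \<in> sets S}"
    by (rule sets_vimage_algebra2[OF Wsp])
  \<comment> \<open>Measurability with respect to \<open>?F\<close>, and not merely
    \<open>M\<close>, is what makes the candidate kernel \<open>?F\<close>-measurable.\<close>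
  have WF [measurable]: "W \<in> ?F \<rightarrow>\<^sub>M S"
    by (rule measurable_vimage_algebra1[OF Wsp])
  have "subalgebra M ?F"
    unfolding subalgebra_def F_sets by auto
  then interpret finite_measure_subalgebra M ?F
    by unfold_locales
  have meas: "?\<kappa> \<in> ?F \<rightarrow>\<^sub>M prob_algebra R"
  proof (rule measurable_distr_prob_space2[where M=M])
    show "(\<lambda>_. M) \<in> ?F \<rightarrow>\<^sub>M prob_algebra M"
      using prob_space_axioms by (simp add: space_prob_algebra)
    show "(\<lambda>(x, y). g (W x, V y)) \<in> ?F \<Otimes>\<^sub>M M \<rightarrow>\<^sub>M R"
      by measurable
  qed
  interpret DW: prob_space "distr M S W" by (rule prob_space_distr) fact
  interpret DV: prob_space "distr M T V" by (rule prob_space_distr) fact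
  interpret P: pair_sigma_finite "distr M S W" "distr M T V" ..
  have joint: "distr M S W \<Otimes>\<^sub>M distr M T V = distr M (S \<Otimes>\<^sub>M T) (\<lambda>\<omega>. (W \<omega>, V \<omega>))"
    by (intro distr_pair_eqI W V indep_setD[OF indep] in_vimage_algebra)
  have "AE \<omega> in M. measure (?\<kappa> \<omega>) C
      = real_cond_exp M ?F (indicat_real ((\<lambda>\<omega>. g (W \<omega>, V \<omega>)) -` C \<inter> space M)) \<omega>"
    if C [measurable]: "C \<in> sets R" for C
  proof (rule AE_symmetric, rule real_cond_exp_charact)
    show "(\<lambda>\<omega>. measure (?\<kappa> \<omega>) C) \<in> borel_measurable ?F"
      using measurable_prob_algebraD[OF meas] by measurable
    then show "integrable M (\<lambda>\<omega>. measure (?\<kappa> \<omega>) C)"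
      by (intro integrable_const_bound[of _ 1] measurable_from_subalg[OF subalg])
         (auto intro!: AE_I2 prob_space.prob_le_1 prob_space_distr measurable_compose[OF _ g]
           simp: measurable_Pair2)
    have gC: "(\<lambda>\<omega>. g (W \<omega>, V \<omega>)) -` C \<inter> space M \<in> sets M"
      by measurable
    then show "integrable M (indicat_real ((\<lambda>\<omega>. g (W \<omega>, V \<omega>)) -` C \<inter> space M))"
      by (rule integrable_real_indicator) (simp add: emeasure_eq_measure)
    fix D assume "D \<in> sets ?F"
    then obtain B where B [measurable]: "B \<in> sets S" and D: "D = W -` B \<inter> space M"
      unfolding F_sets by auto
    \<comment> \<open>Every event of \<open>?F\<close> is the preimage of some \<open>B\<close>
      under \<open>W\<close>, so integrating over it means inserting the factor for
      \<open>B\<close>. Integrating out \<open>v\<close> first leaves the mass that the kernel gives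
      to \<open>C\<close>.\<close>
    let ?f = "\<lambda>(w, v). indicat_real B w * indicat_real C (g (w, v))"
    have int: "integrable (distr M S W \<Otimes>\<^sub>M distr M T V) ?f"
    proof -
      interpret PP: pair_prob_space "distr M S W" "distr M T V" ..
      show ?thesis
        by (rule PP.P.integrable_const_bound[of _ 1]) (auto split: split_indicator)
    qed
    have "(\<integral>\<omega>\<in>D. indicat_real ((\<lambda>\<omega>. g (W \<omega>, V \<omega>)) -` C \<inter> space M) \<omega> \<partial>M)
        = (\<integral>\<omega>. ?f (W \<omega>, V \<omega>) \<partial>M)"
      unfolding set_lebesgue_integral_def D
      by (intro Bochner_Integration.integral_cong) (auto split: split_indicator)
    also have "\<dots> = (\<integral>x. ?f x \<partial>distr M (S \<Otimes>\<^sub>M T) (\<lambda>\<omega>. (W \<omega>, V \<omega>)))"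
      by (subst integral_distr) auto
    also have "\<dots> = (\<integral>w. \<integral>v. ?f (w, v) \<partial>distr M T V \<partial>distr M S W)"
      unfolding joint[symmetric] by (rule P.integral_fst'[OF int, symmetric])
    also have "\<dots> = (\<integral>w. indicat_real B w * (\<integral>\<omega>'. indicat_real C (g (w, V \<omega>')) \<partial>M) \<partial>distr M S W)"
      by (intro Bochner_Integration.integral_cong refl) (simp add: integral_distr)
    also have "\<dots> = (\<integral>\<omega>. indicat_real B (W \<omega>) * (\<integral>\<omega>'. indicat_real C (g (W \<omega>, V \<omega>')) \<partial>M) \<partial>M)"
      by (subst integral_distr) auto
    also have "\<dots> = (\<integral>\<omega>\<in>D. measure (?\<kappa> \<omega>) C \<partial>M)"
      unfolding set_lebesgue_integral_def D
    proof (intro Bochner_Integration.integral_cong refl)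
      fix \<omega> assume \<omega>: "\<omega> \<in> space M"
      have m: "(\<lambda>\<omega>'. g (W \<omega>, V \<omega>')) \<in> M \<rightarrow>\<^sub>M R"
        using \<omega> Wsp by (intro measurable_compose[OF _ g] measurable_Pair1') auto
      have "(\<integral>\<omega>'. indicat_real C (g (W \<omega>, V \<omega>')) \<partial>M) = (\<integral>y. indicat_real C y \<partial>?\<kappa> \<omega>)"
        using m by (subst integral_distr) auto
      also have "\<dots> = measure (?\<kappa> \<omega>) C" using sets.sets_into_space[OF C] by (simp add: Int_absorb2)
      finally show "indicat_real B (W \<omega>) * (\<integral>\<omega>'. indicat_real C (g (W \<omega>, V \<omega>')) \<partial>M)
         = indicat_real (W -` B \<inter> space M) \<omega> *\<^sub>R measure (?\<kappa> \<omega>) C"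
        using \<omega> by (simp split: split_indicator)
    qed
    finally show "(\<integral>\<omega>\<in>D. indicat_real ((\<lambda>\<omega>. g (W \<omega>, V \<omega>)) -` C \<inter> space M) \<omega> \<partial>M)
        = (\<integral>\<omega>\<in>D. measure (?\<kappa> \<omega>) C \<partial>M)" .
  qed
  with meas show ?thesis
    unfolding is_cond_distr_def by blast
qed

text \<open>The theorem speaks of every version of the conditional distribution; this lets one
  explicit version stand for all of them. The exceptional null set may depend on the event, hence
  the second countable target.\<close>

lemma is_cond_distr_unique:
  fixes Y :: "'a \<Rightarrow> 'b::second_countable_topology"
  assumes "is_cond_distr M F borel Y \<kappa>" "is_cond_distr M F borel Y \<kappa>'"
    and sp: "space F = space M"
  shows "AE \<omega> in M. \<kappa> \<omega> = \<kappa>' \<omega>"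
proof -
  obtain B :: "'b set set" where B: "countable B" "topological_basis B"
    using ex_countable_basis by blast
  \<comment> \<open>Finite intersections of basis sets form a countable generator stable under intersection, so
    one null set serves all of them.\<close>
  define E where "E = Inter ` {\<F>. finite \<F> \<and> \<F> \<subseteq> B}"
  have "countable E"
    unfolding E_def using B by (intro countable_image countable_Collect_finite_subset)
  have BE: "B \<subseteq> E"
    unfolding E_def by (auto intro!: image_eqI[of _ _ "{_}"])
  have E_borel: "A \<in> sets borel" if "A \<in> E" for A
    using that B unfolding E_def
    by (auto intro!: borel_open open_Inter dest: topological_basis_open)
  have sets_E: "sets (borel :: 'b measure) = sigma_sets UNIV E"
  proof
    have "sets (borel :: 'b measure) = sigma_sets UNIV B"
      by (simp add: borel_eq_countable_basis[OF B])
    also have "\<dots> \<subseteq> sigma_sets UNIV E"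
      by (rule sigma_sets_subseteq[OF BE])
    finally show "sets (borel :: 'b measure) \<subseteq> sigma_sets UNIV E" .
    show "sigma_sets UNIV E \<subseteq> sets (borel :: 'b measure)"
      using sets.sigma_sets_subset[of E "borel :: 'b measure"] E_borel by auto
  qed
  have "Int_stable E"
  proof (rule Int_stableI)
    fix a b assume "a \<in> E" "b \<in> E"
    then obtain F G where *: "finite F" "F \<subseteq> B" "a = \<Inter>F" "finite G" "G \<subseteq> B" "b = \<Inter>G"
      unfolding E_def by auto
    then have "a \<inter> b = \<Inter>(F \<union> G)" by auto
    with * show "a \<inter> b \<in> E"
      unfolding E_def by (intro image_eqI[of _ _ "F \<union> G"]) auto
  qed
  \<comment> \<open>The empty family contributes \<open>UNIV\<close>, which alone serves as the
    countable cover of finite measure when the two measures are identified on the generator.\<close>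
  have UE: "UNIV \<in> E"
    unfolding E_def by (rule image_eqI[of _ _ "{}"]) auto
  have "AE \<omega> in M. \<forall>A\<in>E. measure (\<kappa> \<omega>) A = measure (\<kappa>' \<omega>) A"
    unfolding AE_ball_countable[OF \<open>countable E\<close>]
  proof
    fix A assume "A \<in> E"
    then have "A \<in> sets borel" by (rule E_borel)
    with assms(1,2) have "AE \<omega> in M. measure (\<kappa> \<omega>) A = real_cond_exp M F (indicat_real (Y -` A \<inter> space M)) \<omega>"
      "AE \<omega> in M. measure (\<kappa>' \<omega>) A = real_cond_exp M F (indicat_real (Y -` A \<inter> space M)) \<omega>"
      unfolding is_cond_distr_def by auto
    then show "AE \<omega> in M. measure (\<kappa> \<omega>) A = measure (\<kappa>' \<omega>) A"
      by eventually_elim simp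
  qed
  then show ?thesis
    using AE_space
  proof eventually_elim
    fix \<omega> assume *: "\<forall>A\<in>E. measure (\<kappa> \<omega>) A = measure (\<kappa>' \<omega>) A" and "\<omega> \<in> space M"
    then have "\<omega> \<in> space F" using sp by simp
    then have "\<kappa> \<omega> \<in> space (prob_algebra borel)" "\<kappa>' \<omega> \<in> space (prob_algebra borel)"
      using assms(1,2) unfolding is_cond_distr_def by (auto dest: measurable_space)
    then have p: "prob_space (\<kappa> \<omega>)" "prob_space (\<kappa>' \<omega>)"
      and s: "sets (\<kappa> \<omega>) = sets borel" "sets (\<kappa>' \<omega>) = sets borel"
      by (auto simp: space_prob_algebra)
    interpret k: prob_space "\<kappa> \<omega>" by fact
    interpret k': prob_space "\<kappa>' \<omega>" by fact
    show "\<kappa> \<omega> = \<kappa>' \<omega>"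
      by (rule measure_eqI_generator_eq_countable[OF \<open>Int_stable E\<close>, of UNIV _ _ "{UNIV}"])
         (use * UE sets_E s in \<open>auto simp: k.emeasure_eq_measure k'.emeasure_eq_measure\<close>)
  qed
qed

section \<open>Gaussian characteristic functions\<close>

lemma std_normal_vec_density_eq_prod:
  "std_normal_vec_density d x = (\<Prod>i<d. std_normal_density (x i))"
proof -
  have "(2 * pi) powr (- real d / 2) = (1 / sqrt (2 * pi)) ^ d"
    by (simp add: powr_minus powr_half_sqrt[symmetric] powr_powr[symmetric] powr_realpow[symmetric]
        divide_simps powr_mult[symmetric] powr_divide powr_powr mult.commute)
  moreover have "exp (- (norm_vec d x)\<^sup>2 / 2) = (\<Prod>i<d. exp (- (x i)\<^sup>2 / 2))"
    by (simp add: norm_vec_def L2_set_def sum_nonneg exp_sum[symmetric] sum_negf sum_divide_distrib)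
  ultimately show ?thesis
    by (simp add: std_normal_vec_density_def std_normal_density_def prod_dividef power_divide)
qed

lemma integral_std_normal_density_iexp:
  "(CLBINT x. of_real (std_normal_density x) * iexp (t * x)) = of_real (exp (- t\<^sup>2 / 2))"
  using fun_cong[OF char_std_normal_distribution, of t]
  by (simp add: char_def integral_density scaleR_conv_of_real)

lemma integrable_std_normal_density_iexp:
  "complex_integrable lborel (\<lambda>x. of_real (std_normal_density x) * iexp (t * x))"
proof (rule Bochner_Integration.integrable_bound)
  show "integrable lborel std_normal_density" by simp
qed (auto simp: norm_mult)

text \<open>Both the density and the exponential factor over the coordinates, so the integral is a
  product of one-dimensional ones. The value depends on \<open>v\<close> only through its norm,
  which is how norms of combinations of the copies of \<open>X\<close> enter.\<close>

lemma std_normal_vec_iexp: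
  assumes "std_normal_vec M d X"
  shows "(CLINT \<omega>|M. iexp (inner_vec d (X \<omega>) v)) = of_real (exp (- (norm_vec d v)\<^sup>2 / 2))"
proof -
  interpret product_sigma_finite "\<lambda>_::nat. lborel :: real measure"
    by unfold_locales
  have D: "distributed M (lborel_vec d) X (\<lambda>x. ennreal (std_normal_vec_density d x))"
    using assms by (simp add: std_normal_vec_def)
  note [measurable] = distributed_measurable[OF D]
  have [measurable]: "(\<lambda>x. inner_vec d x v) \<in> borel_measurable (lborel_vec d)"
    unfolding inner_vec_def by measurable
  have [measurable]: "std_normal_vec_density d \<in> borel_measurable (lborel_vec d)"
    unfolding std_normal_vec_density_eq_prod[abs_def] by measurable
  have "(CLINT \<omega>|M. iexp (inner_vec d (X \<omega>) v))
      = (CLINT x|distr M (lborel_vec d) X. iexp (inner_vec d x v))"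
    by (subst integral_distr) auto
  also have "\<dots> = (CLINT x|lborel_vec d. std_normal_vec_density d x *\<^sub>R iexp (inner_vec d x v))"
    unfolding distributed_distr_eq_density[OF D]
    by (subst integral_density) (auto simp: std_normal_vec_density_eq_prod intro!: prod_nonneg)
  also have "\<dots> = (CLINT x|lborel_vec d. \<Prod>i<d. of_real (std_normal_density (x i)) * iexp (v i * x i))"
    by (simp add: std_normal_vec_density_eq_prod inner_vec_def scaleR_conv_of_real prod.distrib
        sum_distrib_left exp_sum mult_ac)
  also have "\<dots> = (\<Prod>i<d. of_real (exp (- (v i)\<^sup>2 / 2)))"
    by (subst product_integral_prod[where f="\<lambda>i x. of_real (std_normal_density x) * iexp (v i * x)"])
       (simp_all only: finite_lessThan integral_std_normal_density_iexp integrable_std_normal_density_iexp)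
  also have "\<dots> = of_real (exp (- (norm_vec d v)\<^sup>2 / 2))"
    by (simp add: norm_vec_def L2_set_def sum_nonneg exp_sum[symmetric] sum_negf sum_divide_distrib
        flip: of_real_prod)
  finally show ?thesis .
qed

lemma (in prob_space) integral_iexp_sum_indep:
  fixes Y :: "'i \<Rightarrow> 'a \<Rightarrow> real"
  assumes "finite I" and indep: "indep_vars (\<lambda>_. borel) Y I"
  shows "(CLINT \<omega>|M. iexp (\<Sum>i\<in>I. Y i \<omega>)) = (\<Prod>i\<in>I. CLINT \<omega>|M. iexp (Y i \<omega>))"
proof -
  have ind: "indep_vars (\<lambda>_. borel) (\<lambda>i \<omega>. iexp (Y i \<omega>)) I"
    by (rule indep_vars_compose2[OF indep]) measurable
  have "(CLINT \<omega>|M. iexp (\<Sum>i\<in>I. Y i \<omega>)) = (CLINT \<omega>|M. \<Prod>i\<in>I. iexp (Y i \<omega>))"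
    using \<open>finite I\<close> by (simp add: sum_distrib_left exp_sum)
  also have "\<dots> = (\<Prod>i\<in>I. CLINT \<omega>|M. iexp (Y i \<omega>))"
    using indep \<open>finite I\<close>
    by (intro indep_vars_lebesgue_integral[OF _ ind] integrable_iexp) (auto simp: indep_vars_def)
  finally show ?thesis .
qed

lemma (in prob_space) normal_iexp:
  assumes "\<sigma> > 0" and D: "distributed M lborel Z (\<lambda>x. ennreal (normal_density 0 \<sigma> x))"
  shows "(CLINT \<omega>|M. iexp (t * Z \<omega>)) = of_real (exp (- \<sigma>\<^sup>2 * t\<^sup>2 / 2))"
proof -
  have D': "distributed M lborel (\<lambda>\<omega>. Z \<omega> / \<sigma>) std_normal_density"
    using normal_standard_normal_convert[OF \<open>\<sigma> > 0\<close>, of Z 0] D by simp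
  have m: "(\<lambda>\<omega>. Z \<omega> / \<sigma>) \<in> M \<rightarrow>\<^sub>M lborel"
    by (rule distributed_measurable[OF D'])
  have "(CLINT \<omega>|M. iexp (t * Z \<omega>)) = (CLINT \<omega>|M. iexp ((\<sigma> * t) * (Z \<omega> / \<sigma>)))"
    using \<open>\<sigma> > 0\<close> by simp
  also have "\<dots> = (CLINT x|distr M lborel (\<lambda>\<omega>. Z \<omega> / \<sigma>). iexp ((\<sigma> * t) * x))"
    by (subst integral_distr[OF m]) auto
  also have "\<dots> = of_real (exp (- (\<sigma> * t)\<^sup>2 / 2))"
    unfolding distributed_distr_eq_density[OF D']
    using integral_std_normal_density_iexp[of "\<sigma> * t"]
    by (subst integral_density) (auto simp: scaleR_conv_of_real)
  finally show ?thesis by (simp add: power_mult_distrib)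
qed

section \<open>Characteristic functions of the limit matrix and of independent Gaussian
  vectors\<close>

lemma trace_transpose_mult:
  fixes U y :: "real^'k^'l"
  shows "trace (transpose U ** y) = (\<Sum>j\<in>UNIV. \<Sum>r\<in>UNIV. U $ j $ r * y $ j $ r)"
  unfolding trace_def matrix_matrix_mult_def transpose_def
  by (simp add: sum.swap[of _ "UNIV :: 'k set"])

lemma borel_measurable_trace_transpose_mult [measurable]:
  "(\<lambda>y. trace (transpose U ** y)) \<in> borel_measurable (borel :: (real^'k^'l) measure)"
  unfolding trace_transpose_mult by (intro borel_measurable_continuous_onI continuous_intros)

text \<open>The trace is a single sum over index pairs, so independence of the entries splits the
  integral into scalar Gaussian ones. The exponent contains the squared Frobenius norm of
  \<open>U\<close>.\<close>

lemma (in prob_space) char_mat_normal: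
  fixes Z :: "'a \<Rightarrow> real^'k^'l"
  assumes "\<sigma> > 0" and [measurable]: "Z \<in> borel_measurable M"
    and Z: "\<And>j r. distributed M lborel (\<lambda>\<omega>. Z \<omega> $ j $ r) (\<lambda>x. ennreal (normal_density 0 \<sigma> x))"
    and indep: "indep_vars (\<lambda>_. borel) (\<lambda>(j, r) \<omega>. Z \<omega> $ j $ r) UNIV"
  shows "char_mat (distr M borel Z) U = of_real (exp (- \<sigma>\<^sup>2 * (\<Sum>j\<in>UNIV. \<Sum>r\<in>UNIV. (U $ j $ r)\<^sup>2) / 2))"
proof -
  have ind: "indep_vars (\<lambda>_. borel) (\<lambda>p \<omega>. U $ fst p $ snd p * (case p of (j, r) \<Rightarrow> \<lambda>\<omega>. Z \<omega> $ j $ r) \<omega>) UNIV"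
    by (rule indep_vars_compose2[OF indep]) measurable
  have "char_mat (distr M borel Z) U = (CLINT \<omega>|M. iexp (trace (transpose U ** Z \<omega>)))"
    unfolding char_mat_def by (subst integral_distr) auto
  also have "\<dots> = (CLINT \<omega>|M. iexp (\<Sum>p\<in>UNIV. U $ fst p $ snd p * (case p of (j, r) \<Rightarrow> \<lambda>\<omega>. Z \<omega> $ j $ r) \<omega>))"
    unfolding trace_transpose_mult sum.cartesian_product by (simp add: case_prod_beta)
  also have "\<dots> = (\<Prod>p\<in>UNIV. CLINT \<omega>|M. iexp (U $ fst p $ snd p * (case p of (j, r) \<Rightarrow> \<lambda>\<omega>. Z \<omega> $ j $ r) \<omega>))"
    by (rule integral_iexp_sum_indep[OF _ ind]) simp
  also have "\<dots> = (\<Prod>p\<in>UNIV. of_real (exp (- \<sigma>\<^sup>2 * (U $ fst p $ snd p)\<^sup>2 / 2)))"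
    using normal_iexp[OF \<open>\<sigma> > 0\<close> Z] by (intro prod.cong refl) (auto simp: case_prod_beta)
  also have "\<dots> = of_real (exp (- \<sigma>\<^sup>2 * (\<Sum>j\<in>UNIV. \<Sum>r\<in>UNIV. (U $ j $ r)\<^sup>2) / 2))"
    unfolding sum.cartesian_product of_real_prod[symmetric]
    by (simp add: exp_sum[symmetric] sum_distrib_left sum_negf sum_divide_distrib case_prod_beta)
  finally show ?thesis .
qed

text \<open>The vectors \<open>v j\<close> are deterministic here. In the main proof they are
  combinations of copies of \<open>X\<close> frozen at a sample point, which Fubini permits.\<close>

lemma (in prob_space) std_normal_family_iexp:
  fixes \<Xi> :: "'l::finite \<Rightarrow> 'a \<Rightarrow> nat \<Rightarrow> real"
  assumes N: "\<And>j. std_normal_vec M d (\<Xi> j)"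
    and indep: "indep_vars (\<lambda>_. borel_vec d) \<Xi> UNIV"
  shows "(CLINT \<omega>|M. iexp (\<Sum>j\<in>UNIV. inner_vec d (\<Xi> j \<omega>) (v j)))
       = of_real (exp (- (\<Sum>j\<in>UNIV. (norm_vec d (v j))\<^sup>2) / 2))"
proof -
  have ind: "indep_vars (\<lambda>_. borel) (\<lambda>j \<omega>. inner_vec d (\<Xi> j \<omega>) (v j)) UNIV"
    by (rule indep_vars_compose2[OF indep]) (unfold inner_vec_def, measurable)
  have "(CLINT \<omega>|M. iexp (\<Sum>j\<in>UNIV. inner_vec d (\<Xi> j \<omega>) (v j)))
      = (\<Prod>j\<in>UNIV. of_real (exp (- (norm_vec d (v j))\<^sup>2 / 2)))"
    by (subst integral_iexp_sum_indep[OF finite ind]) (simp only: std_normal_vec_iexp[OF N])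
  then show ?thesis
    by (simp add: exp_sum[symmetric] sum_negf sum_divide_distrib flip: of_real_prod)
qed

section \<open>Convergence in probability\<close>

text \<open>Truncation at 1 is subadditive on nonnegative reals. This separates the error of a
  quadratic form into truncated errors of single inner products.\<close>

lemma min_1_sum_le:
  fixes x :: "'i \<Rightarrow> real"
  assumes "finite I" "\<And>i. i \<in> I \<Longrightarrow> 0 \<le> x i"
  shows "min 1 (\<Sum>i\<in>I. x i) \<le> (\<Sum>i\<in>I. min 1 (x i))"
  using assms
proof (induction I rule: finite_induct)
  case (insert i I)
  then have "min 1 (\<Sum>i\<in>I. x i) \<le> (\<Sum>i\<in>I. min 1 (x i))" "0 \<le> x i" "0 \<le> (\<Sum>i\<in>I. x i)"
    by (auto intro: sum_nonneg)
  with insert.hyps show ?case by auto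
qed simp

text \<open>On the nonnegative half-line \<open>exp (- x)\<close> is 1-Lipschitz and stays between 0
  and 1. Keeping both bounds in one \<open>min\<close> makes convergence in probability sufficient
  later, without moment assumptions.\<close>

lemma abs_exp_minus_diff_le:
  fixes a b :: real
  assumes "0 \<le> a" "0 \<le> b"
  shows "\<bar>exp (- a) - exp (- b)\<bar> \<le> min 1 \<bar>a - b\<bar>"
proof -
  have *: "exp (- x) - exp (- y) \<le> min 1 (y - x)" if "0 \<le> x" "x \<le> y" for x y :: real
  proof -
    \<comment> \<open>Applied with \<open>e = exp (- (y - x))\<close>: positivity gives the bound 1,
      the tangent line of the exponential at 0 gives the bound \<open>y - x\<close>.\<close>
    have lin: "1 - e \<le> min 1 (y - x)" if "0 < e" "1 + (x - y) \<le> e" for e :: real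
      using that by linarith
    have "exp (- x) - exp (- y) = exp (- x) * (1 - exp (- (y - x)))"
      by (simp add: algebra_simps flip: exp_add)
    also have "\<dots> \<le> 1 * (1 - exp (- (y - x)))"
      using that by (intro mult_right_mono) auto
    also have "\<dots> \<le> min 1 (y - x)"
      using lin[OF exp_gt_zero exp_ge_add_one_self] by (simp add: minus_diff_eq)
    finally show ?thesis .
  qed
  show ?thesis
    using *[of a b] *[of b a] assms by (cases "a \<le> b") (auto simp: abs_if)
qed

text \<open>Convergence to a constant depends only on the individual laws. Limits can thus be
  carried from \<open>X\<close> to its copies and to other probability spaces.\<close>

lemma tendsto_in_prob_cong_distr:
  fixes Y :: "nat \<Rightarrow> 'a \<Rightarrow> real" and Y' :: "nat \<Rightarrow> 'b \<Rightarrow> real"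
  assumes "tendsto_in_prob M Y c"
    and Y: "\<And>n. Y n \<in> borel_measurable (M n)"
    and Y': "\<And>n. Y' n \<in> borel_measurable (M' n)"
    and eq: "\<And>n. distr (M' n) borel (Y' n) = distr (M n) borel (Y n)"
  shows "tendsto_in_prob M' Y' c"
proof -
  have "measure (M' n) {\<omega>\<in>space (M' n). dist (Y' n \<omega>) c > \<epsilon>}
      = measure (M n) {\<omega>\<in>space (M n). dist (Y n \<omega>) c > \<epsilon>}" for n \<epsilon>
  proof -
    have S: "{y. dist y c > \<epsilon>} \<in> sets borel" by measurable
    have "measure (M' n) {\<omega>\<in>space (M' n). dist (Y' n \<omega>) c > \<epsilon>}
        = measure (distr (M' n) borel (Y' n)) {y. dist y c > \<epsilon>}"
      using measure_distr[OF Y' S] by (simp add: vimage_def Int_def conj_commute)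
    also have "\<dots> = measure (M n) {\<omega>\<in>space (M n). dist (Y n \<omega>) c > \<epsilon>}"
      unfolding eq using measure_distr[OF Y S] by (simp add: vimage_def Int_def conj_commute)
    finally show ?thesis .
  qed
  with assms(1) show ?thesis
    by (simp add: tendsto_in_prob_def)
qed

text \<open>\<open>Y'\<close> carries no measurability assumption, since it will come from an
  arbitrary version of the conditional distribution. An almost sure inclusion into the measurable
  event for \<open>Y\<close> gives the upper bound, which is enough.\<close>

lemma tendsto_in_prob_cong_AE:
  fixes Y Y' :: "nat \<Rightarrow> 'a \<Rightarrow> 'b::{second_countable_topology, metric_space}"
  assumes lim: "tendsto_in_prob M Y c" and M: "\<And>n. prob_space (M n)"
    and [measurable]: "\<And>n. Y n \<in> borel_measurable (M n)"
    and eq: "\<And>n. AE \<omega> in M n. Y n \<omega> = Y' n \<omega>"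
  shows "tendsto_in_prob M Y' c"
  unfolding tendsto_in_prob_def
proof (intro allI impI)
  fix \<epsilon> :: real assume "\<epsilon> > 0"
  show "(\<lambda>n. measure (M n) {\<omega>\<in>space (M n). dist (Y' n \<omega>) c > \<epsilon>}) \<longlonglongrightarrow> 0"
  proof (rule Lim_null_comparison)
    show "(\<lambda>n. measure (M n) {\<omega>\<in>space (M n). dist (Y n \<omega>) c > \<epsilon>}) \<longlonglongrightarrow> 0"
      using lim \<open>\<epsilon> > 0\<close> by (simp add: tendsto_in_prob_def)
    show "eventually (\<lambda>n. norm (measure (M n) {\<omega>\<in>space (M n). dist (Y' n \<omega>) c > \<epsilon>})
        \<le> measure (M n) {\<omega>\<in>space (M n). dist (Y n \<omega>) c > \<epsilon>}) sequentially"
    proof (intro always_eventually allI)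
      fix n
      interpret prob_space "M n" by (rule M)
      show "norm (prob {\<omega>\<in>space (M n). dist (Y' n \<omega>) c > \<epsilon>}) \<le> prob {\<omega>\<in>space (M n). dist (Y n \<omega>) c > \<epsilon>}"
        unfolding real_norm_def abs_of_nonneg[OF measure_nonneg]
      proof (rule finite_measure_mono_AE)
        show "{\<omega>\<in>space (M n). dist (Y n \<omega>) c > \<epsilon>} \<in> sets (M n)"
          by measurable
      qed (use eq[of n] in eventually_elim, auto)
    qed
  qed
qed

text \<open>Without truncation the expectations need not converge. With it, the integrand is at most
  1 on the event of a large deviation, whose probability vanishes, and is small elsewhere.\<close>

lemma tendsto_in_prob_expectation_min:
  fixes Y :: "nat \<Rightarrow> 'a \<Rightarrow> real"
  assumes M: "\<And>n. prob_space (M n)"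
    and Y [measurable]: "\<And>n. Y n \<in> borel_measurable (M n)"
    and lim: "tendsto_in_prob M Y y" and "0 \<le> c"
  shows "(\<lambda>n. \<integral>\<omega>. min 1 (c * \<bar>Y n \<omega> - y\<bar>) \<partial>M n) \<longlonglongrightarrow> 0"
proof (rule tendstoI)
  fix e :: real assume "e > 0"
  \<comment> \<open>Half of \<open>e\<close> is spent on small deviations and half on the
    exceptional event; \<open>c + 1\<close> keeps the denominator positive when
    \<open>c = 0\<close>.\<close>
  define \<epsilon> where "\<epsilon> = e / (2 * (c + 1))"
  have \<epsilon>: "\<epsilon> > 0" "c * \<epsilon> \<le> e / 2"
    using \<open>e > 0\<close> \<open>0 \<le> c\<close> by (auto simp: \<epsilon>_def field_simps)
  have "eventually (\<lambda>n. measure (M n) {\<omega>\<in>space (M n). dist (Y n \<omega>) y > \<epsilon>} < e / 2) sequentially"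
    using lim \<epsilon> \<open>e > 0\<close> by (intro order_tendstoD(2)[of _ 0]) (auto simp: tendsto_in_prob_def)
  then show "eventually (\<lambda>n. dist (\<integral>\<omega>. min 1 (c * \<bar>Y n \<omega> - y\<bar>) \<partial>M n) 0 < e) sequentially"
  proof eventually_elim
    case (elim n)
    let ?B = "{\<omega>\<in>space (M n). dist (Y n \<omega>) y > \<epsilon>}"
    interpret prob_space "M n" by (rule M)
    have "(\<integral>\<omega>. min 1 (c * \<bar>Y n \<omega> - y\<bar>) \<partial>M n) \<le> (\<integral>\<omega>. e / 2 + indicat_real ?B \<omega> \<partial>M n)"
    proof (rule integral_mono)
      show "integrable (M n) (\<lambda>\<omega>. min 1 (c * \<bar>Y n \<omega> - y\<bar>))"
        using \<open>0 \<le> c\<close> by (intro integrable_const_bound[of _ 1]) auto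
      show "integrable (M n) (\<lambda>\<omega>. e / 2 + indicat_real ?B \<omega>)"
        by (intro Bochner_Integration.integrable_add integrable_const integrable_real_indicator)
           (auto simp: emeasure_eq_measure)
      fix \<omega> assume "\<omega> \<in> space (M n)"
      show "min 1 (c * \<bar>Y n \<omega> - y\<bar>) \<le> e / 2 + indicat_real ?B \<omega>"
      proof (cases "\<omega> \<in> ?B")
        case False
        with \<open>\<omega> \<in> space (M n)\<close> have "c * \<bar>Y n \<omega> - y\<bar> \<le> c * \<epsilon>"
          using \<open>0 \<le> c\<close> by (intro mult_left_mono) (auto simp: dist_real_def)
        with \<epsilon> False show ?thesis by simp
      qed (use \<open>e > 0\<close> in auto)
    qed
    also have "\<dots> = e / 2 + prob ?B"
      by (subst Bochner_Integration.integral_add)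
         (auto simp: emeasure_eq_measure prob_space intro!: integrable_real_indicator)
    also have "\<dots> < e" using elim by simp
    finally have "(\<integral>\<omega>. min 1 (c * \<bar>Y n \<omega> - y\<bar>) \<partial>M n) < e" .
    moreover have "0 \<le> (\<integral>\<omega>. min 1 (c * \<bar>Y n \<omega> - y\<bar>) \<partial>M n)"
      using \<open>0 \<le> c\<close> by (intro integral_nonneg_AE) auto
    ultimately show ?case by simp
  qed
qed

section \<open>Quadratic forms in inner products, and second moments of partial characteristic
  functions\<close>

lemma inner_vec_commute: "inner_vec d x y = inner_vec d y x"
  by (simp add: inner_vec_def mult.commute)

lemma norm_vec_power2: "(norm_vec d x)\<^sup>2 = inner_vec d x x"
  by (simp add: norm_vec_def inner_vec_def L2_set_def sum_nonneg power2_eq_square)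

lemma inner_vec_sum_right:
  "inner_vec d x (\<lambda>i. \<Sum>m\<in>I. a m * v m i) = (\<Sum>m\<in>I. a m * inner_vec d x (v m))"
  unfolding inner_vec_def
  by (simp add: sum_distrib_left sum.swap[of _ "{..<d}" I] mult_ac)

text \<open>Gram expansion: only pairwise inner products remain, and these are the quantities whose
  limits are known.\<close>

lemma norm_vec_sum_power2:
  "(norm_vec d (\<lambda>i. \<Sum>m\<in>I. a m * v m i))\<^sup>2
     = (\<Sum>m\<in>I. \<Sum>m'\<in>I. a m * a m' * inner_vec d (v m) (v m'))"
  unfolding norm_vec_power2 inner_vec_sum_right
  by (subst inner_vec_commute, subst inner_vec_sum_right) (simp add: sum_distrib_left mult_ac inner_vec_commute)

lemma borel_measurable_inner_vec [measurable (raw)]: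
  assumes "f \<in> M \<rightarrow>\<^sub>M borel_vec d" "g \<in> M \<rightarrow>\<^sub>M borel_vec d"
  shows "(\<lambda>x. inner_vec d (f x) (g x)) \<in> borel_measurable M"
  using assms unfolding inner_vec_def by measurable

text \<open>The form differs from its limit by a fixed finite linear combination of inner product
  errors, each tending to 0 in probability. The number of terms does not depend on the dimension
  \<open>d n\<close>, and truncation makes the expected errors vanish.\<close>

lemma exp_quadratic_form_tendsto:
  fixes V :: "nat \<Rightarrow> 'm::finite \<Rightarrow> 'a \<Rightarrow> nat \<Rightarrow> real" and A :: "'l::finite \<Rightarrow> 'm \<Rightarrow> real"
  assumes M: "\<And>n. prob_space (M n)"
    and V: "\<And>n m. V n m \<in> M n \<rightarrow>\<^sub>M borel_vec (d n)"
    and lim: "\<And>m m'. tendsto_in_prob M (\<lambda>n \<omega>. inner_vec (d n) (V n m \<omega>) (V n m' \<omega>)) (if m = m' then s else 0)"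
    and "0 \<le> s"
  shows "(\<lambda>n. \<integral>\<omega>. exp (- (\<Sum>j\<in>UNIV. (norm_vec (d n) (\<lambda>i. \<Sum>m\<in>UNIV. A j m * V n m \<omega> i))\<^sup>2) / 2) \<partial>M n)
           \<longlonglongrightarrow> exp (- (s * (\<Sum>j\<in>UNIV. \<Sum>m\<in>UNIV. (A j m)\<^sup>2)) / 2)"
proof -
  note [measurable] = V
  define Q where "Q n \<omega> = (\<Sum>j\<in>UNIV. (norm_vec (d n) (\<lambda>i. \<Sum>m\<in>UNIV. A j m * V n m \<omega> i))\<^sup>2)" for n \<omega>
  define q where "q = s * (\<Sum>j\<in>UNIV. \<Sum>m\<in>UNIV. (A j m)\<^sup>2)"
  \<comment> \<open>Indexing by triples turns the difference of the nested sums into one finite sum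
    of coefficients \<open>c\<close> times errors \<open>D\<close>; the first index is a dummy in
    \<open>D\<close>.\<close>
  define c where "c = (\<lambda>(j, m, m'). A j m * A j m')"
  define D where "D n \<omega> = (\<lambda>(j :: 'l, m, m'). inner_vec (d n) (V n m \<omega>) (V n m' \<omega>) - (if m = m' then s else 0))" for n \<omega>
  have Q: "Q n \<omega> = (\<Sum>j\<in>UNIV. \<Sum>m\<in>UNIV. \<Sum>m'\<in>UNIV. A j m * A j m' * inner_vec (d n) (V n m \<omega>) (V n m' \<omega>))" for n \<omega>
    unfolding Q_def norm_vec_sum_power2 ..
  \<comment> \<open>The limiting Gram matrix is \<open>s\<close> times the identity. Writing
    \<open>q\<close> with its vanishing off-diagonal terms allows termwise comparison with
    \<open>Q\<close>.\<close>
  have q: "q = (\<Sum>j\<in>UNIV. \<Sum>m\<in>UNIV. \<Sum>m'\<in>UNIV. A j m * A j m' * (if m = m' then s else 0))"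
    unfolding q_def by (simp add: sum_distrib_left power2_eq_square if_distrib cong: if_cong) (simp add: mult_ac)
  have Qq: "Q n \<omega> - q = (\<Sum>p\<in>UNIV. c p * D n \<omega> p)" for n \<omega>
    unfolding Q q c_def D_def sum_subtractf[symmetric] right_diff_distrib[symmetric]
      sum.cartesian_product
    by (intro sum.cong) (auto simp: algebra_simps)
  have [measurable]: "Q n \<in> borel_measurable (M n)" for n
    unfolding Q[abs_def] by measurable
  have D_meas [measurable]: "(\<lambda>\<omega>. D n \<omega> p) \<in> borel_measurable (M n)" for n p
    unfolding D_def by (cases p) auto
  have pos: "0 \<le> Q n \<omega>" "0 \<le> q" for n \<omega>
    unfolding Q_def q_def using \<open>0 \<le> s\<close> by (auto intro!: sum_nonneg mult_nonneg_nonneg)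
  have le: "\<bar>exp (- Q n \<omega> / 2) - exp (- q / 2)\<bar> \<le> (\<Sum>p\<in>UNIV. min 1 (\<bar>c p\<bar> * \<bar>D n \<omega> p\<bar>))" for n \<omega>
  proof -
    have "\<bar>exp (- Q n \<omega> / 2) - exp (- q / 2)\<bar> \<le> min 1 \<bar>Q n \<omega> / 2 - q / 2\<bar>"
      using abs_exp_minus_diff_le[of "Q n \<omega> / 2" "q / 2"] pos by simp
    also have "\<dots> \<le> min 1 \<bar>Q n \<omega> - q\<bar>"
      by auto
    also have "\<dots> \<le> min 1 (\<Sum>p\<in>UNIV. \<bar>c p\<bar> * \<bar>D n \<omega> p\<bar>)"
      unfolding Qq using sum_abs[of "\<lambda>p. c p * D n \<omega> p" UNIV] by (simp add: abs_mult min_le_iff_disj)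
    also have "\<dots> \<le> (\<Sum>p\<in>UNIV. min 1 (\<bar>c p\<bar> * \<bar>D n \<omega> p\<bar>))"
      by (rule min_1_sum_le) auto
    finally show ?thesis .
  qed
  have "(\<lambda>n. \<integral>\<omega>. exp (- Q n \<omega> / 2) \<partial>M n) \<longlonglongrightarrow> exp (- q / 2)"
  proof (rule Lim_null_comparison[THEN LIM_zero_cancel])
    show "(\<lambda>n. \<Sum>p\<in>UNIV. \<integral>\<omega>. min 1 (\<bar>c p\<bar> * \<bar>D n \<omega> p\<bar>) \<partial>M n) \<longlonglongrightarrow> 0"
    proof (rule tendsto_null_sum)
      fix p :: "'l \<times> 'm \<times> 'm"
      obtain j m m' where p: "p = (j, m, m')" by (cases p)
      show "(\<lambda>n. \<integral>\<omega>. min 1 (\<bar>c p\<bar> * \<bar>D n \<omega> p\<bar>) \<partial>M n) \<longlonglongrightarrow> 0"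
        unfolding D_def p prod.case
        by (rule tendsto_in_prob_expectation_min[OF M _ lim]) auto
    qed
    show "eventually (\<lambda>n. norm ((\<integral>\<omega>. exp (- Q n \<omega> / 2) \<partial>M n) - exp (- q / 2))
        \<le> (\<Sum>p\<in>UNIV. \<integral>\<omega>. min 1 (\<bar>c p\<bar> * \<bar>D n \<omega> p\<bar>) \<partial>M n)) sequentially"
    proof (intro always_eventually allI)
      fix n
      interpret prob_space "M n" by (rule M)
      have int: "integrable (M n) (\<lambda>\<omega>. exp (- Q n \<omega> / 2))"
        by (rule integrable_const_bound[of _ 1]) (use pos in auto)
      have intD: "integrable (M n) (\<lambda>\<omega>. min 1 (\<bar>c p\<bar> * \<bar>D n \<omega> p\<bar>))" for p
        by (rule integrable_const_bound[of _ 1]) auto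
      have "(\<integral>\<omega>. exp (- Q n \<omega> / 2) \<partial>M n) - exp (- q / 2)
          = (\<integral>\<omega>. exp (- Q n \<omega> / 2) - exp (- q / 2) \<partial>M n)"
        using int by (simp add: prob_space)
      also have "norm \<dots> \<le> (\<integral>\<omega>. \<bar>exp (- Q n \<omega> / 2) - exp (- q / 2)\<bar> \<partial>M n)"
        unfolding real_norm_def[symmetric] by (rule integral_norm_bound)
      also have "\<dots> \<le> (\<integral>\<omega>. (\<Sum>p\<in>UNIV. min 1 (\<bar>c p\<bar> * \<bar>D n \<omega> p\<bar>)) \<partial>M n)"
        by (intro integral_mono le integrable_abs Bochner_Integration.integrable_diff int
            integrable_const Bochner_Integration.integrable_sum intD)
      also have "\<dots> = (\<Sum>p\<in>UNIV. \<integral>\<omega>. min 1 (\<bar>c p\<bar> * \<bar>D n \<omega> p\<bar>) \<partial>M n)"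
        by (intro Bochner_Integration.integral_sum intD)
      finally show "norm ((\<integral>\<omega>. exp (- Q n \<omega> / 2) \<partial>M n) - exp (- q / 2))
        \<le> (\<Sum>p\<in>UNIV. \<integral>\<omega>. min 1 (\<bar>c p\<bar> * \<bar>D n \<omega> p\<bar>) \<partial>M n)" .
    qed
  qed
  then show ?thesis
    unfolding Q_def q_def .
qed

text \<open>As \<open>c\<close> is real, the square expands into \<open>\<phi> * cnj \<phi>\<close>,
  a multiple of \<open>Re \<phi>\<close> and a constant. Fubini then moves the \<open>M1\<close>
  integral inside, where it can be evaluated explicitly if \<open>M1\<close> carries the Gaussian
  vectors; all integrands are bounded, hence integrable.\<close>

lemma (in pair_prob_space) second_moment_partial_char:
  fixes h :: "'a \<Rightarrow> 'b \<Rightarrow> real"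
  assumes h [measurable]: "case_prod h \<in> borel_measurable (M1 \<Otimes>\<^sub>M M2)"
  shows "(\<integral>\<omega>. (cmod ((CLINT y|M2. iexp (h \<omega> y)) - of_real c))\<^sup>2 \<partial>M1)
       = Re (CLINT p|M2 \<Otimes>\<^sub>M M2. CLINT \<omega>|M1. iexp (h \<omega> (fst p) - h \<omega> (snd p)))
         - 2 * c * Re (CLINT y|M2. CLINT \<omega>|M1. iexp (h \<omega> y)) + c\<^sup>2"
proof -
  interpret P22: pair_prob_space M2 M2 ..
  interpret PT: pair_prob_space M1 "M2 \<Otimes>\<^sub>M M2" ..
  define \<phi> where "\<phi> \<omega> = (CLINT y|M2. iexp (h \<omega> y))" for \<omega>
  have [measurable]: "\<phi> \<in> borel_measurable M1"
    unfolding \<phi>_def by measurable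
  have [measurable]: "cnj \<in> borel_measurable borel"
    by (intro borel_measurable_continuous_onI continuous_intros)
  have int_h: "complex_integrable (M1 \<Otimes>\<^sub>M M2) (\<lambda>(\<omega>, y). iexp (h \<omega> y))"
    by (rule P.integrable_const_bound[of _ 1]) auto
  have int_hh: "complex_integrable (M1 \<Otimes>\<^sub>M (M2 \<Otimes>\<^sub>M M2)) (\<lambda>(\<omega>, p). iexp (h \<omega> (fst p) - h \<omega> (snd p)))"
    by (rule PT.P.integrable_const_bound[of _ 1]) auto
  \<comment> \<open>Conjugation reverses the sign of the real phase, so the product of the two
    integrals is one integral over independent points with the phases subtracted.\<close>
  have \<phi>_sq: "\<phi> \<omega> * cnj (\<phi> \<omega>) = (CLINT p|M2 \<Otimes>\<^sub>M M2. iexp (h \<omega> (fst p) - h \<omega> (snd p)))"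
    if "\<omega> \<in> space M1" for \<omega>
  proof -
    have [measurable]: "h \<omega> \<in> borel_measurable M2"
      using measurable_compose[OF measurable_Pair1'[OF that] h] by simp
    have int: "complex_integrable (M2 \<Otimes>\<^sub>M M2) (\<lambda>p. iexp (h \<omega> (fst p) - h \<omega> (snd p)))"
      by (rule P22.P.integrable_const_bound[of _ 1]) auto
    have "(CLINT p|M2 \<Otimes>\<^sub>M M2. iexp (h \<omega> (fst p) - h \<omega> (snd p)))
        = (CLINT y|M2. CLINT y'|M2. iexp (h \<omega> y - h \<omega> y'))"
      using P22.integral_fst'[OF int] by simp
    also have "\<dots> = (CLINT y|M2. CLINT y'|M2. iexp (h \<omega> y) * cnj (iexp (h \<omega> y')))"
      by (simp add: exp_cnj exp_diff right_diff_distrib exp_minus divide_inverse)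
    also have "\<dots> = \<phi> \<omega> * cnj (\<phi> \<omega>)"
      by (simp add: \<phi>_def)
    finally show ?thesis ..
  qed
  have le1: "cmod (\<phi> \<omega>) \<le> 1" for \<omega>
  proof -
    have "cmod (\<phi> \<omega>) \<le> (\<integral>y. cmod (iexp (h \<omega> y)) \<partial>M2)"
      unfolding \<phi>_def by (rule integral_norm_bound)
    also have "\<dots> = 1" by (simp add: M2.prob_space)
    finally show ?thesis .
  qed
  have int_\<phi>: "complex_integrable M1 \<phi>"
    by (rule M1.integrable_const_bound[of _ 1]) (use le1 in auto)
  have int_\<phi>\<phi>: "complex_integrable M1 (\<lambda>\<omega>. \<phi> \<omega> * cnj (\<phi> \<omega>))"
    by (rule M1.integrable_const_bound[of _ 1])
       (use le1 in \<open>auto simp: norm_mult intro!: mult_le_one\<close>)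
  have "(\<integral>\<omega>. (cmod (\<phi> \<omega> - of_real c))\<^sup>2 \<partial>M1)
      = (\<integral>\<omega>. Re (\<phi> \<omega> * cnj (\<phi> \<omega>)) - 2 * c * Re (\<phi> \<omega>) + c\<^sup>2 \<partial>M1)"
    by (simp only: cmod_power2) (simp add: power2_eq_square algebra_simps)
  also have "\<dots> = Re (CLINT \<omega>|M1. \<phi> \<omega> * cnj (\<phi> \<omega>)) - 2 * c * Re (CLINT \<omega>|M1. \<phi> \<omega>) + c\<^sup>2"
  proof -
    have 1: "integrable M1 (\<lambda>\<omega>. Re (\<phi> \<omega> * cnj (\<phi> \<omega>)))"
      by (rule integrable_Re[OF int_\<phi>\<phi>])
    have 2: "integrable M1 (\<lambda>\<omega>. 2 * c * Re (\<phi> \<omega>))"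
      by (intro integrable_mult_right integrable_Re int_\<phi>)
    have "(\<integral>\<omega>. Re (\<phi> \<omega> * cnj (\<phi> \<omega>)) - 2 * c * Re (\<phi> \<omega>) + c\<^sup>2 \<partial>M1)
        = (\<integral>\<omega>. Re (\<phi> \<omega> * cnj (\<phi> \<omega>)) \<partial>M1) - (\<integral>\<omega>. 2 * c * Re (\<phi> \<omega>) \<partial>M1) + (\<integral>\<omega>. c\<^sup>2 \<partial>M1)"
      using 1 2 by (simp del: Re_complex_of_real integral_mult_right_zero)
    then show ?thesis
      using integral_Re[OF int_\<phi>\<phi>] integral_Re[OF int_\<phi>] by (simp add: M1.prob_space)
  qed
  also have "(CLINT \<omega>|M1. \<phi> \<omega> * cnj (\<phi> \<omega>))
      = (CLINT \<omega>|M1. CLINT p|M2 \<Otimes>\<^sub>M M2. iexp (h \<omega> (fst p) - h \<omega> (snd p)))"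
    by (intro Bochner_Integration.integral_cong refl \<phi>_sq)
  also have "\<dots> = (CLINT p|M2 \<Otimes>\<^sub>M M2. CLINT \<omega>|M1. iexp (h \<omega> (fst p) - h \<omega> (snd p)))"
    by (rule PT.Fubini_integral[OF int_hh, symmetric])
  also have "(CLINT \<omega>|M1. \<phi> \<omega>) = (CLINT y|M2. CLINT \<omega>|M1. iexp (h \<omega> y))"
    unfolding \<phi>_def by (rule Fubini_integral[OF int_h, symmetric])
  finally show ?thesis
    unfolding \<phi>_def .
qed

text \<open>Chebyshev's argument: Markov's inequality for the squared distance to
  \<open>c\<close>.\<close>

lemma tendsto_in_prob_of_second_moment:
  fixes Y :: "nat \<Rightarrow> 'a \<Rightarrow> complex"
  assumes M: "\<And>n. prob_space (M n)"
    and [measurable]: "\<And>n. Y n \<in> borel_measurable (M n)"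
    and int: "\<And>n. integrable (M n) (\<lambda>\<omega>. (cmod (Y n \<omega> - c))\<^sup>2)"
    and lim: "(\<lambda>n. \<integral>\<omega>. (cmod (Y n \<omega> - c))\<^sup>2 \<partial>M n) \<longlonglongrightarrow> 0"
  shows "tendsto_in_prob M Y c"
  unfolding tendsto_in_prob_def
proof (intro allI impI)
  fix \<epsilon> :: real assume "\<epsilon> > 0"
  show "(\<lambda>n. measure (M n) {\<omega>\<in>space (M n). dist (Y n \<omega>) c > \<epsilon>}) \<longlonglongrightarrow> 0"
  proof (rule Lim_null_comparison)
    show "(\<lambda>n. (\<integral>\<omega>. (cmod (Y n \<omega> - c))\<^sup>2 \<partial>M n) / \<epsilon>\<^sup>2) \<longlonglongrightarrow> 0"
      using lim \<open>\<epsilon> > 0\<close> by (auto intro: tendsto_divide_zero)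
    show "eventually (\<lambda>n. norm (measure (M n) {\<omega>\<in>space (M n). dist (Y n \<omega>) c > \<epsilon>})
        \<le> (\<integral>\<omega>. (cmod (Y n \<omega> - c))\<^sup>2 \<partial>M n) / \<epsilon>\<^sup>2) sequentially"
    proof (intro always_eventually allI)
      fix n
      interpret prob_space "M n" by (rule M)
      have "prob {\<omega>\<in>space (M n). dist (Y n \<omega>) c > \<epsilon>} \<le> prob {\<omega>\<in>space (M n). \<epsilon>\<^sup>2 \<le> (cmod (Y n \<omega> - c))\<^sup>2}"
        using \<open>\<epsilon> > 0\<close> by (intro finite_measure_mono) (auto simp: dist_norm intro: power_mono)
      also have "\<dots> \<le> (\<integral>\<omega>. (cmod (Y n \<omega> - c))\<^sup>2 \<partial>M n) / \<epsilon>\<^sup>2"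
        using \<open>\<epsilon> > 0\<close> by (intro integral_Markov_inequality_measure[where A="{}"] int) auto
      finally show "norm (prob {\<omega>\<in>space (M n). dist (Y n \<omega>) c > \<epsilon>})
          \<le> (\<integral>\<omega>. (cmod (Y n \<omega> - c))\<^sup>2 \<partial>M n) / \<epsilon>\<^sup>2"
        by simp
    qed
  qed
qed

section \<open>Transfer of limits to copies and to product spaces\<close>

lemma distr_pair_snd:
  assumes "prob_space M" "prob_space N"
  shows "distr (M \<Otimes>\<^sub>M N) N snd = N"
proof (intro measure_eqI)
  interpret M: prob_space M by fact
  interpret N: prob_space N by fact
  fix A assume A: "A \<in> sets (distr (M \<Otimes>\<^sub>M N) N snd)"
  then have "snd -` A \<inter> space (M \<Otimes>\<^sub>M N) = space M \<times> A"
    by (auto simp: space_pair_measure dest: sets.sets_into_space)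
  with A show "emeasure (distr (M \<Otimes>\<^sub>M N) N snd) A = emeasure N A"
    by (simp add: emeasure_distr N.emeasure_pair_measure_Times M.emeasure_space_1)
qed simp

lemma sum_UNIV_sum_type:
  "(\<Sum>m\<in>UNIV. f m) = (\<Sum>r\<in>UNIV. f (Inl r)) + (\<Sum>r\<in>UNIV. f (Inr r))"
  for f :: "'i::finite + 'j::finite \<Rightarrow> 'c::comm_monoid_add"
  unfolding UNIV_Plus_UNIV[symmetric] by (subst sum.Plus) (auto simp: comp_def)

lemma borel_measurable_vec_lambda:
  fixes f :: "'a \<Rightarrow> 'i::finite \<Rightarrow> 'b::euclidean_space"
  assumes [measurable]: "\<And>i. (\<lambda>x. f x i) \<in> borel_measurable M"
  shows "(\<lambda>x. \<chi> i. f x i) \<in> borel_measurable M"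
  by (subst borel_measurable_euclidean_space) (auto simp: Basis_vec_def inner_axis)

text \<open>The law of an inner product is the image of the joint law of its two arguments, so equal
  joint laws suffice, even on different spaces.\<close>

lemma tendsto_in_prob_inner_copies:
  fixes V V' :: "nat \<Rightarrow> 'b \<Rightarrow> nat \<Rightarrow> real" and X X' :: "nat \<Rightarrow> 'a \<Rightarrow> nat \<Rightarrow> real"
  assumes lim: "tendsto_in_prob M (\<lambda>n \<omega>. inner_vec (d n) (X n \<omega>) (X' n \<omega>)) c"
    and X [measurable]: "\<And>n. X n \<in> M n \<rightarrow>\<^sub>M borel_vec (d n)" "\<And>n. X' n \<in> M n \<rightarrow>\<^sub>M borel_vec (d n)"
    and V [measurable]: "\<And>n. V n \<in> P n \<rightarrow>\<^sub>M borel_vec (d n)" "\<And>n. V' n \<in> P n \<rightarrow>\<^sub>M borel_vec (d n)"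
    and eq: "\<And>n. distr (P n) (borel_vec (d n) \<Otimes>\<^sub>M borel_vec (d n)) (\<lambda>\<omega>. (V n \<omega>, V' n \<omega>))
                = distr (M n) (borel_vec (d n) \<Otimes>\<^sub>M borel_vec (d n)) (\<lambda>\<omega>. (X n \<omega>, X' n \<omega>))"
  shows "tendsto_in_prob P (\<lambda>n \<omega>. inner_vec (d n) (V n \<omega>) (V' n \<omega>)) c"
proof (rule tendsto_in_prob_cong_distr[OF lim])
  fix n
  let ?S = "borel_vec (d n) \<Otimes>\<^sub>M borel_vec (d n)"
  have "distr (P n) borel (\<lambda>\<omega>. inner_vec (d n) (V n \<omega>) (V' n \<omega>))
      = distr (distr (P n) ?S (\<lambda>\<omega>. (V n \<omega>, V' n \<omega>))) borel (\<lambda>p. inner_vec (d n) (fst p) (snd p))"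
    by (subst distr_distr) (auto simp: comp_def)
  also have "\<dots> = distr (M n) borel (\<lambda>\<omega>. inner_vec (d n) (X n \<omega>) (X' n \<omega>))"
    unfolding eq by (subst distr_distr) (auto simp: comp_def)
  finally show "distr (P n) borel (\<lambda>\<omega>. inner_vec (d n) (V n \<omega>) (V' n \<omega>))
      = distr (M n) borel (\<lambda>\<omega>. inner_vec (d n) (X n \<omega>) (X' n \<omega>))" .
qed measurable

text \<open>Here equality of the single laws suffices: pushing them along the diagonal map gives
  equal joint laws of the pairs \<open>(V, V)\<close> and \<open>(X, X)\<close>.\<close>

lemma tendsto_in_prob_norm_copies:
  fixes V :: "nat \<Rightarrow> 'b \<Rightarrow> nat \<Rightarrow> real" and X :: "nat \<Rightarrow> 'a \<Rightarrow> nat \<Rightarrow> real"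
  assumes lim: "tendsto_in_prob M (\<lambda>n \<omega>. (norm_vec (d n) (X n \<omega>))\<^sup>2) c"
    and X [measurable]: "\<And>n. X n \<in> M n \<rightarrow>\<^sub>M borel_vec (d n)"
    and V [measurable]: "\<And>n. V n \<in> P n \<rightarrow>\<^sub>M borel_vec (d n)"
    and eq: "\<And>n. distr (P n) (borel_vec (d n)) (V n) = distr (M n) (borel_vec (d n)) (X n)"
  shows "tendsto_in_prob P (\<lambda>n \<omega>. inner_vec (d n) (V n \<omega>) (V n \<omega>)) c"
proof (rule tendsto_in_prob_inner_copies[where X=X and X'=X])
  show "tendsto_in_prob M (\<lambda>n \<omega>. inner_vec (d n) (X n \<omega>) (X n \<omega>)) c"
    using lim by (simp add: norm_vec_power2)
  fix n
  let ?S = "borel_vec (d n) \<Otimes>\<^sub>M borel_vec (d n)"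
  have "distr (P n) ?S (\<lambda>\<omega>. (V n \<omega>, V n \<omega>)) = distr (distr (P n) (borel_vec (d n)) (V n)) ?S (\<lambda>x. (x, x))"
    by (subst distr_distr) (auto simp: comp_def)
  also have "\<dots> = distr (M n) ?S (\<lambda>\<omega>. (X n \<omega>, X n \<omega>))"
    unfolding eq by (subst distr_distr) (auto simp: comp_def)
  finally show "distr (P n) ?S (\<lambda>\<omega>. (V n \<omega>, V n \<omega>)) = distr (M n) ?S (\<lambda>\<omega>. (X n \<omega>, X n \<omega>))" .
qed measurable

lemma (in prob_space) indep_vars_imp_distr_pair:
  assumes X: "indep_vars N X I" and "i \<in> I" "j \<in> I" "i \<noteq> j"
  shows "distr M (N i \<Otimes>\<^sub>M N j) (\<lambda>\<omega>. (X i \<omega>, X j \<omega>)) = distr M (N i) (X i) \<Otimes>\<^sub>M distr M (N j) (X j)"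
proof (rule distr_pair_eqI[symmetric])
  show m: "X i \<in> M \<rightarrow>\<^sub>M N i" "X j \<in> M \<rightarrow>\<^sub>M N j"
    using assms by (auto simp: indep_vars_def)
  fix A B assume AB: "A \<in> sets (N i)" "B \<in> sets (N j)"
  \<comment> \<open>Since \<open>i \<noteq> j\<close>, one function can prescribe \<open>A\<close>
    at \<open>i\<close> and \<open>B\<close> at \<open>j\<close>, and the product formula over
    \<open>{i, j}\<close> applies.\<close>
  let ?C = "\<lambda>k. if k = i then A else B"
  have "?C k \<in> sets (N k)" if "k \<in> {i, j}" for k
    using that AB by auto
  with indep_varsD[OF X, of "{i, j}" ?C] assms(2-4)
  show "prob ((X i -` A \<inter> space M) \<inter> (X j -` B \<inter> space M))
      = prob (X i -` A \<inter> space M) * prob (X j -` B \<inter> space M)"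
    by simp
qed

section \<open>Conditional convergence to the Gaussian matrix\<close>

theorem theorem2p1:
  fixes \<sigma> :: real
    and d :: "nat \<Rightarrow> nat"
    and M :: "nat \<Rightarrow> 'a measure"
    and X X' :: "nat \<Rightarrow> 'a \<Rightarrow> nat \<Rightarrow> real"
    and Xc :: "nat \<Rightarrow> 'k::finite \<Rightarrow> 'a \<Rightarrow> nat \<Rightarrow> real"
    and \<Xi> :: "nat \<Rightarrow> 'l::finite \<Rightarrow> 'a \<Rightarrow> nat \<Rightarrow> real"
    and N :: "'b measure"
    and Z :: "'b \<Rightarrow> real^'k^'l"
  assumes \<sigma>: "\<sigma> > 0"
    and d_pos: "\<And>n. d n > 0"
    and d_mono: "mono d"
    and d_lim: "filterlim d at_top sequentially"
    and M: "\<And>n. prob_space (M n)"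
    and X_density: "\<And>n. has_continuous_density (M n) (d n) (X n)"
    and X'_copy: "\<And>n. copy_of (M n) (borel_vec (d n)) (X' n) (X n)"
    and X'_indep: "\<And>n. prob_space.indep_var (M n) (borel_vec (d n)) (X n) (borel_vec (d n)) (X' n)"
    and X_norm: "tendsto_in_prob M (\<lambda>n \<omega>. (norm_vec (d n) (X n \<omega>))\<^sup>2) (\<sigma>\<^sup>2)"
    and X_inner: "tendsto_in_prob M (\<lambda>n \<omega>. inner_vec (d n) (X n \<omega>) (X' n \<omega>)) 0"
    and Xc_copy: "\<And>n r. copy_of (M n) (borel_vec (d n)) (Xc n r) (X n)"
    and Xc_indep: "\<And>n. prob_space.indep_vars (M n) (\<lambda>_. borel_vec (d n)) (Xc n) UNIV"
    and \<Xi>_normal: "\<And>n j. std_normal_vec (M n) (d n) (\<Xi> n j)"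
    and \<Xi>_indep: "\<And>n. prob_space.indep_vars (M n) (\<lambda>_. borel_vec (d n)) (\<Xi> n) UNIV"
    and \<Xi>_Xc_indep: "\<And>n. prob_space.indep_set (M n)
          (sets (gen_sigma (M n) (borel_vec (d n)) (\<Xi> n)))
          (sets (gen_sigma (M n) (borel_vec (d n)) (Xc n)))"
    and N: "prob_space N"
    and Z_meas: "Z \<in> borel_measurable N"
    and Z_normal: "\<And>j r. distributed N lborel (\<lambda>\<omega>. Z \<omega> $ j $ r) (\<lambda>x. ennreal (normal_density 0 \<sigma> x))"
    and Z_indep: "prob_space.indep_vars N (\<lambda>_. borel) (\<lambda>(j, r) \<omega>. Z \<omega> $ j $ r) UNIV"
  shows "(\<exists>\<kappa>. \<forall>n. is_cond_distr (M n) (gen_sigma (M n) (borel_vec (d n)) (\<Xi> n)) borel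
                    (inner_matrix (d n) (\<Xi> n) (Xc n)) (\<kappa> n)) \<and>
         (\<forall>\<kappa>. (\<forall>n. is_cond_distr (M n) (gen_sigma (M n) (borel_vec (d n)) (\<Xi> n)) borel
                    (inner_matrix (d n) (\<Xi> n) (Xc n)) (\<kappa> n)) \<longrightarrow>
            weak_conv_in_prob M \<kappa> (distr N borel Z))"
proof -
  have X_meas [measurable]: "X n \<in> M n \<rightarrow>\<^sub>M borel_vec (d n)"
    and X'_meas [measurable]: "X' n \<in> M n \<rightarrow>\<^sub>M borel_vec (d n)" for n
    using prob_space.indep_var_rv1[OF M X'_indep] prob_space.indep_var_rv2[OF M X'_indep] by auto
  have Xc_meas [measurable]: "Xc n r \<in> M n \<rightarrow>\<^sub>M borel_vec (d n)"
    and Xc_distr: "distr (M n) (borel_vec (d n)) (Xc n r) = distr (M n) (borel_vec (d n)) (X n)" for n r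
    using Xc_copy by (auto simp: copy_of_def)
  have \<Xi>_meas [measurable]: "\<Xi> n j \<in> M n \<rightarrow>\<^sub>M borel_vec (d n)" for n j
    using \<Xi>_indep[of n] by (auto simp: prob_space.indep_vars_def[OF M])
  \<comment> \<open>The explicit version: \<open>\<omega>\<close> fixes the Gaussian vectors, while
    \<open>\<omega>'\<close> averages over the copies of \<open>X\<close>. It settles existence and
    is the reference for every other version.\<close>
  define \<kappa> where "\<kappa> n \<omega> = distr (M n) borel (\<lambda>\<omega>'. \<chi> j r. inner_vec (d n) (\<Xi> n j \<omega>) (Xc n r \<omega>'))" for n \<omega>
  have \<kappa>: "is_cond_distr (M n) (gen_sigma (M n) (borel_vec (d n)) (\<Xi> n)) borel
      (inner_matrix (d n) (\<Xi> n) (Xc n)) (\<kappa> n)" for n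
  proof -
    interpret prob_space "M n" by (rule M)
    let ?g = "\<lambda>(\<xi>, x). (\<chi> j r. inner_vec (d n) (\<xi> j) (x r)) :: real^'k^'l"
    have "?g \<in> borel_measurable (Pi\<^sub>M UNIV (\<lambda>_. borel_vec (d n)) \<Otimes>\<^sub>M Pi\<^sub>M UNIV (\<lambda>_. borel_vec (d n)))"
      unfolding case_prod_beta
      by (intro borel_measurable_vec_lambda borel_measurable_inner_vec) measurable
    moreover have "(\<lambda>\<omega> j. \<Xi> n j \<omega>) \<in> M n \<rightarrow>\<^sub>M Pi\<^sub>M UNIV (\<lambda>_. borel_vec (d n))"
      "(\<lambda>\<omega> r. Xc n r \<omega>) \<in> M n \<rightarrow>\<^sub>M Pi\<^sub>M UNIV (\<lambda>_. borel_vec (d n))"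
      using measurable_restrict[of UNIV "\<Xi> n" "M n" "\<lambda>_. borel_vec (d n)"]
        measurable_restrict[of UNIV "Xc n" "M n" "\<lambda>_. borel_vec (d n)"] \<Xi>_meas Xc_meas
      by (simp_all add: restrict_UNIV)
    ultimately show ?thesis
      using is_cond_distr_of_indep[OF _ _ \<Xi>_Xc_indep[of n, unfolded gen_sigma_def], of ?g borel]
      by (simp add: gen_sigma_def inner_matrix_def[abs_def] \<kappa>_def[abs_def])
  qed
  have "tendsto_in_prob M (\<lambda>n \<omega>. char_mat (\<kappa>' n \<omega>) U) (char_mat (distr N borel Z) U)"
    if \<kappa>': "\<And>n. is_cond_distr (M n) (gen_sigma (M n) (borel_vec (d n)) (\<Xi> n)) borel
                    (inner_matrix (d n) (\<Xi> n) (Xc n)) (\<kappa>' n)" for \<kappa>' U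
  proof -
    define S where "S n = borel_vec (d n)" for n
    define c where "c = exp (- (\<sigma>\<^sup>2 * (\<Sum>j\<in>UNIV. \<Sum>r\<in>UNIV. (U $ j $ r)\<^sup>2)) / 2)"
    \<comment> \<open>Grouped by \<open>j\<close>, the phase is a sum of inner products of Gaussian
      vectors with vectors that are constant once \<open>\<omega>'\<close> is fixed, as the Gaussian
      integral requires.\<close>
    define h where "h n \<omega> \<omega>' = (\<Sum>j\<in>UNIV. inner_vec (d n) (\<Xi> n j \<omega>) (\<lambda>i. \<Sum>r\<in>UNIV. U $ j $ r * Xc n r \<omega>' i))" for n \<omega> \<omega>'
    \<comment> \<open>\<open>V\<close> joins the copies carried by the two factors of \<open>M n \<Otimes>\<^sub>M M n\<close>; the signs in \<open>A\<close> come from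
      the complex conjugate in \<open>\<bar>\<phi>\<bar>\<^sup>2\<close>.\<close>
    define A where "A j = case_sum (\<lambda>r. U $ j $ r) (\<lambda>r. - U $ j $ r)" for j
    define V where "V n = case_sum (\<lambda>r p. Xc n r (fst p)) (\<lambda>r p. Xc n r (snd p))" for n
    have h: "h n \<omega> \<omega>' = (\<Sum>j\<in>UNIV. \<Sum>r\<in>UNIV. U $ j $ r * inner_vec (d n) (\<Xi> n j \<omega>) (Xc n r \<omega>'))" for n \<omega> \<omega>'
      unfolding h_def inner_vec_sum_right ..
    have h_meas [measurable]: "case_prod (h n) \<in> borel_measurable (M n \<Otimes>\<^sub>M M n)" for n
      unfolding h case_prod_beta by measurable
    have h_diff: "h n \<omega> (fst p) - h n \<omega> (snd p)
        = (\<Sum>j\<in>UNIV. inner_vec (d n) (\<Xi> n j \<omega>) (\<lambda>i. \<Sum>m\<in>UNIV. A j m * V n m p i))" for n \<omega> p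
      unfolding h inner_vec_sum_right
      unfolding sum_UNIV_sum_type
      by (simp add: A_def V_def sum_subtractf sum_negf)
    have char_\<kappa>: "char_mat (\<kappa> n \<omega>) U = (CLINT \<omega>'|M n. iexp (h n \<omega> \<omega>'))" if "\<omega> \<in> space (M n)" for n \<omega>
    proof -
      have m: "(\<lambda>\<omega>'. (\<chi> j r. inner_vec (d n) (\<Xi> n j \<omega>) (Xc n r \<omega>')) :: real^'k^'l) \<in> borel_measurable (M n)"
        using measurable_space[OF \<Xi>_meas that]
        by (intro borel_measurable_vec_lambda borel_measurable_inner_vec) auto
      have "(\<lambda>y. iexp (trace (transpose U ** y))) \<in> borel_measurable borel"
        by measurable
      from integral_distr[OF m this] show ?thesis
        unfolding char_mat_def \<kappa>_def by (simp add: trace_transpose_mult h)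
    qed
    have char_Z: "char_mat (distr N borel Z) U = of_real c"
      using prob_space.char_mat_normal[OF N \<sigma> Z_meas Z_normal Z_indep, of U] by (simp add: c_def)
    \<comment> \<open>Each row of \<open>A\<close> contains the row of \<open>U\<close> twice up to
      sign, so the sum of squares doubles and the exponential is squared.\<close>
    have c2: "c\<^sup>2 = exp (- (\<sigma>\<^sup>2 * (\<Sum>j\<in>UNIV. \<Sum>m\<in>UNIV. (A j m)\<^sup>2)) / 2)"
      unfolding c_def sum_UNIV_sum_type
      by (simp add: A_def sum.distrib algebra_simps flip: exp_double sum_distrib_left)
    have V_meas [measurable]: "V n m \<in> M n \<Otimes>\<^sub>M M n \<rightarrow>\<^sub>M borel_vec (d n)" for n m
      unfolding V_def by (cases m) auto
    have pair: "prob_space (M n \<Otimes>\<^sub>M M n)" for n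
      by (intro prob_space_pair M)
    \<comment> \<open>This product law is the common reference: every pair of distinct copies, on
      \<open>M n\<close> or on the product space, is shown to have it.\<close>
    have XX': "distr (M n) (S n \<Otimes>\<^sub>M S n) (\<lambda>\<omega>. (X n \<omega>, X' n \<omega>)) = distr (M n) (S n) (X n) \<Otimes>\<^sub>M distr (M n) (S n) (X n)" for n
      using X'_indep[of n] X'_copy[of n] unfolding prob_space.indep_var_distribution_eq[OF M] copy_of_def S_def
      by auto
    have XcXc: "distr (M n) (S n \<Otimes>\<^sub>M S n) (\<lambda>\<omega>. (Xc n r \<omega>, Xc n r' \<omega>)) = distr (M n) (S n \<Otimes>\<^sub>M S n) (\<lambda>\<omega>. (X n \<omega>, X' n \<omega>))"
      if "r \<noteq> r'" for n r r'
      using prob_space.indep_vars_imp_distr_pair[OF M Xc_indep, of r r' n] that Xc_distr XX' by (simp add: S_def)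
    \<comment> \<open>The diagonal limits come from the norm hypothesis, the others from the
      hypothesis on an independent copy.\<close>
    have Xc_lim: "tendsto_in_prob M (\<lambda>n \<omega>. inner_vec (d n) (Xc n r \<omega>) (Xc n r' \<omega>)) (if r = r' then \<sigma>\<^sup>2 else 0)" for r r'
    proof (cases "r = r'")
      case True
      then show ?thesis
        using tendsto_in_prob_norm_copies[OF X_norm X_meas Xc_meas Xc_distr] by simp
    next
      case False
      then show ?thesis
        using tendsto_in_prob_inner_copies[OF X_inner X_meas X'_meas Xc_meas Xc_meas XcXc[unfolded S_def]] by simp
    qed
    have fst_distr: "distr (M n \<Otimes>\<^sub>M M n) borel (\<lambda>p. f (fst p)) = distr (M n) borel f"
      and snd_distr: "distr (M n \<Otimes>\<^sub>M M n) borel (\<lambda>p. f (snd p)) = distr (M n) borel f"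
      if [measurable]: "f \<in> borel_measurable (M n)" for n and f :: "'a \<Rightarrow> real"
      using distr_distr[OF that measurable_fst, of "M n"] distr_distr[OF that measurable_snd, of "M n"]
        prob_space.distr_pair_fst[OF M, of "M n" n] distr_pair_snd[OF M M, of n n]
      by (simp_all add: comp_def)
    \<comment> \<open>The two factors of the product space are independent, so the limit is 0 even
      when \<open>r = r'\<close>.\<close>
    have cross: "tendsto_in_prob (\<lambda>n. M n \<Otimes>\<^sub>M M n) (\<lambda>n p. inner_vec (d n) (Xc n r (fst p)) (Xc n r' (snd p))) 0" for r r'
    proof (rule tendsto_in_prob_inner_copies[OF X_inner X_meas X'_meas])
      fix n
      have "prob_space (distr (M n) (S n) (Xc n r'))"
        by (intro prob_space.prob_space_distr M) (simp add: S_def)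
      then have "distr (M n \<Otimes>\<^sub>M M n) (S n \<Otimes>\<^sub>M S n) (\<lambda>p. (Xc n r (fst p), Xc n r' (snd p)))
          = distr (M n) (S n) (Xc n r) \<Otimes>\<^sub>M distr (M n) (S n) (Xc n r')"
        by (subst pair_measure_distr) (auto simp: S_def case_prod_beta' prob_space_imp_sigma_finite)
      then show "distr (M n \<Otimes>\<^sub>M M n) (borel_vec (d n) \<Otimes>\<^sub>M borel_vec (d n)) (\<lambda>p. (Xc n r (fst p), Xc n r' (snd p)))
          = distr (M n) (borel_vec (d n) \<Otimes>\<^sub>M borel_vec (d n)) (\<lambda>\<omega>. (X n \<omega>, X' n \<omega>))"
        using XX'[of n] Xc_distr by (simp add: S_def)
    qed measurable
    \<comment> \<open>Indices on the same side live on one factor and reduce to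
      \<open>Xc_lim\<close> by projection; indices on opposite sides are covered by
      \<open>cross\<close>.\<close>
    have V_lim: "tendsto_in_prob (\<lambda>n. M n \<Otimes>\<^sub>M M n) (\<lambda>n p. inner_vec (d n) (V n m p) (V n m' p)) (if m = m' then \<sigma>\<^sup>2 else 0)" for m m'
    proof (cases m; cases m')
      fix r r' assume "m = Inl r" "m' = Inl r'"
      then show ?thesis
        using tendsto_in_prob_cong_distr[OF Xc_lim[of r r'] _ _ fst_distr] by (simp add: V_def)
    next
      fix r r' assume "m = Inr r" "m' = Inr r'"
      then show ?thesis
        using tendsto_in_prob_cong_distr[OF Xc_lim[of r r'] _ _ snd_distr] by (simp add: V_def)
    next
      fix r r' assume "m = Inl r" "m' = Inr r'"
      then show ?thesis using cross[of r r'] by (simp add: V_def)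
    next
      fix r r' assume "m = Inr r" "m' = Inl r'"
      then show ?thesis using cross[of r' r] by (simp add: V_def inner_vec_commute)
    qed
    \<comment> \<open>\<open>a\<close> and \<open>b\<close> are what integrating out the Gaussian
      vectors leaves of the characters with phase \<open>h\<close> and with a difference of two such
      phases.\<close>
    define a where "a n \<omega>' = exp (- (\<Sum>j\<in>UNIV. (norm_vec (d n) (\<lambda>i. \<Sum>r\<in>UNIV. U $ j $ r * Xc n r \<omega>' i))\<^sup>2) / 2)" for n \<omega>'
    define b where "b n p = exp (- (\<Sum>j\<in>UNIV. (norm_vec (d n) (\<lambda>i. \<Sum>m\<in>UNIV. A j m * V n m p i))\<^sup>2) / 2)" for n p
    have a_lim: "(\<lambda>n. \<integral>\<omega>'. a n \<omega>' \<partial>M n) \<longlonglongrightarrow> c"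
      unfolding a_def c_def by (rule exp_quadratic_form_tendsto[OF M Xc_meas Xc_lim]) simp
    have b_lim: "(\<lambda>n. \<integral>p. b n p \<partial>(M n \<Otimes>\<^sub>M M n)) \<longlonglongrightarrow> c\<^sup>2"
      unfolding b_def c2 by (rule exp_quadratic_form_tendsto[OF pair V_meas V_lim]) simp
    define \<phi> where "\<phi> n \<omega> = (CLINT \<omega>'|M n. iexp (h n \<omega> \<omega>'))" for n \<omega>
    have \<phi>_meas [measurable]: "\<phi> n \<in> borel_measurable (M n)" for n
    proof -
      interpret prob_space "M n" by (rule M)
      show ?thesis unfolding \<phi>_def[abs_def] by measurable
    qed
    \<comment> \<open>An exact identity for every \<open>n\<close>; all asymptotics enter through
      \<open>a_lim\<close> and \<open>b_lim\<close>.\<close>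
    have second_moment: "(\<integral>\<omega>. (cmod (\<phi> n \<omega> - of_real c))\<^sup>2 \<partial>M n)
        = (\<integral>p. b n p \<partial>(M n \<Otimes>\<^sub>M M n)) - 2 * c * (\<integral>\<omega>'. a n \<omega>' \<partial>M n) + c\<^sup>2" for n
    proof -
      interpret prob_space "M n" by (rule M)
      interpret pair_prob_space "M n" "M n" ..
      have "(CLINT \<omega>|M n. iexp (h n \<omega> \<omega>')) = of_real (a n \<omega>')" for \<omega>'
        unfolding h_def a_def by (rule prob_space.std_normal_family_iexp[OF M \<Xi>_normal \<Xi>_indep])
      moreover have "(CLINT \<omega>|M n. iexp (h n \<omega> (fst p) - h n \<omega> (snd p))) = of_real (b n p)" for p
        unfolding h_diff b_def by (rule prob_space.std_normal_family_iexp[OF M \<Xi>_normal \<Xi>_indep])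
      ultimately show ?thesis
        unfolding \<phi>_def second_moment_partial_char[OF h_meas] by simp
    qed
    have "tendsto_in_prob M \<phi> (of_real c)"
    proof (rule tendsto_in_prob_of_second_moment[OF M])
      fix n
      interpret prob_space "M n" by (rule M)
      show "\<phi> n \<in> borel_measurable (M n)" by (rule \<phi>_meas)
      have "cmod (\<phi> n \<omega>) \<le> 1" for \<omega>
      proof -
        have "cmod (\<phi> n \<omega>) \<le> (\<integral>\<omega>'. cmod (iexp (h n \<omega> \<omega>')) \<partial>M n)"
          unfolding \<phi>_def by (rule integral_norm_bound)
        also have "\<dots> = 1" by (simp add: prob_space)
        finally show ?thesis .
      qed
      then have "cmod (\<phi> n \<omega> - of_real c) \<le> 1 + \<bar>c\<bar>" for \<omega>
        using norm_triangle_ineq4[of "\<phi> n \<omega>" "of_real c"] by (smt (verit) norm_of_real)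
      then show "integrable (M n) (\<lambda>\<omega>. (cmod (\<phi> n \<omega> - of_real c))\<^sup>2)"
        by (intro integrable_const_bound[of _ "(1 + \<bar>c\<bar>)\<^sup>2"]) (auto intro!: power_mono)
    next
      have "(\<lambda>n. \<integral>\<omega>. (cmod (\<phi> n \<omega> - of_real c))\<^sup>2 \<partial>M n) \<longlonglongrightarrow> c\<^sup>2 - 2 * c * c + c\<^sup>2"
        unfolding second_moment by (intro tendsto_intros a_lim b_lim)
      then show "(\<lambda>n. \<integral>\<omega>. (cmod (\<phi> n \<omega> - of_real c))\<^sup>2 \<partial>M n) \<longlonglongrightarrow> 0"
        by (simp add: power2_eq_square)
    qed
    \<comment> \<open>The limit holds for the explicit version and passes to
      \<open>\<kappa>'\<close>, as the two agree almost surely for each \<open>n\<close>.\<close>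
    then show ?thesis
      unfolding char_Z
    proof (rule tendsto_in_prob_cong_AE[OF _ M \<phi>_meas])
      fix n
      have "AE \<omega> in M n. \<kappa> n \<omega> = \<kappa>' n \<omega>"
        by (rule is_cond_distr_unique[OF \<kappa> \<kappa>']) (simp add: gen_sigma_def)
      then show "AE \<omega> in M n. \<phi> n \<omega> = char_mat (\<kappa>' n \<omega>) U"
        using AE_space by eventually_elim (metis char_\<kappa> \<phi>_def)
    qed
  qed
  with \<kappa> show ?thesis
    unfolding weak_conv_in_prob_def by blast
qed

end
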